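(* For every integer $n\ge 0$, \[ \sum_{|w|=n} p(w)\,E(w) = r^n+n-1, \] where the sum is over all words $w$ over $\mathcal{X}$ of length $n$.
   Context: Let $r\ge 2$ be an integer, $\mathcal{X}=\{0,1,\ldots,r-1\}$, and let $p$ be a probability distribution on $\mathcal{X}$ with $p(x)>0$ for all $x\in\mathcal{X}$. A finite word is a finite sequence of letters in $\mathcal{X}$; $\emptyset$ denotes the empty word, $|w|$ the length of $w$, and $w(i)$ its $i$th letter. Products of words are concatenations. Put $p(w)=\prod_{i=1}^{|w|}p(w(i))$, with $p(\emptyset)=1$. Let $X_1,X_2,\ldots$ be independent and identically distributed random variables with distribution $p$, and let $\mathbf{X}=X_1X_2\cdots$ be the corresponding random right-infinite word. For a finite word $w$ and $\xi\in\mathcal{X}^{\mathbb{N}}$, let $T_w(\xi)$ be the minimum of $|w'w|$ over all finite words $w'$ such that $\xi=w'w\xi'$ for some $\xi'\in\mathcal{X}^{\mathbb{N}}$, and $T_w(\xi)=\infty$ if $w$ does not occur in $\xi$. That is, $T_w(\xi)$ is the position at which the first occurrence of $w$ in $\xi$ ends. Define $E(w)$ as the expectation of $T_w(\mathbf{X})$. In particular $E(\emptyset)=0$. *)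

theory Defs
  imports "HOL-Probability.Probability"
begin

text \<open>Finite words are lists, right-infinite words are streams, and \<open>@-\<close> prepends a list to a
  stream.\<close>

definition words :: "nat \<Rightarrow> nat \<Rightarrow> nat list set" where
  "words r n = {w. set w \<subseteq> {..<r} \<and> length w = n}"

definition word_prob :: "'a pmf \<Rightarrow> 'a list \<Rightarrow> real" where
  "word_prob p w = (\<Prod>i<length w. pmf p (w ! i))"

text \<open>If \<open>w\<close> does not occur in \<open>\<xi>\<close>, the set below is empty and its infimum in \<open>enat\<close> is \<open>\<infinity>\<close>;
  otherwise the infimum is attained. No condition is imposed on the letters of \<open>w'\<close> and \<open>\<xi>'\<close>,
  as they all occur in \<open>\<xi>\<close>.\<close>

definition first_occ :: "'a list \<Rightarrow> 'a stream \<Rightarrow> enat" where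
  "first_occ w \<xi> = Inf {enat (length (w' @ w)) |w'. \<exists>\<xi>'. \<xi> = w' @- w @- \<xi>'}"

text \<open>The random variables are indexed from 0. The expectation is taken in \<open>[0,\<infinity>]\<close>, so that no
  integrability is presupposed.\<close>

definition expected_first_occ ::
  "'s measure \<Rightarrow> (nat \<Rightarrow> 's \<Rightarrow> 'a) \<Rightarrow> 'a list \<Rightarrow> ennreal" where
  "expected_first_occ M X w =
     (\<integral>\<^sup>+ \<omega>. ennreal_of_enat (first_occ w (to_stream (\<lambda>i. X i \<omega>))) \<partial>M)"

end

theory Submission imports Defs "HOL-Library.Sublist" begin

text \<open>Let \<open>T\<close> be the end of the first occurrence of \<open>w\<close>. If \<open>T > m\<close> and \<open>w\<close> stands directly after
  the first \<open>m\<close> letters, then \<open>T = m + k\<close> for some \<open>1 \<le> k \<le> |w|\<close> such that \<open>take k w\<close> is a border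
  of \<open>w\<close>. Hence \<open>P(T > m) p(w)\<close> is the sum of \<open>P(T = m + k) p(drop k w)\<close> over the borders.
  This forces \<open>P(T > m) \<longlonglongrightarrow> 0\<close>, and summing over \<open>m\<close> gives
  \<open>p(w) E(w) = (\<Sum>k. p(drop k w))\<close>. In the sum over all \<open>w\<close> of length \<open>n\<close>, the trivial border
  \<open>k = n\<close> contributes \<open>r ^ n\<close>, and every \<open>k < n\<close> contributes \<open>1\<close>, because \<open>drop k\<close> is a bijection
  from the words with a border of length \<open>k\<close> onto the words of length \<open>n - k\<close>.\<close>

section \<open>Words and their probabilities\<close>

lemma finite_words [simp]: "finite (words r n)"
  unfolding words_def by (rule finite_lists_length_eq) simp

lemma card_words: "card (words r n) = r ^ n"
  unfolding words_def using card_lists_length_eq[of "{..<r}" n] by simp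

lemma words_0: "words r 0 = {[]}"
  by (auto simp: words_def)

lemma word_prob_eq_prod_list: "word_prob p w = prod_list (map (pmf p) w)"
  by (simp add: word_prob_def prod.list_conv_set_nth atLeast0LessThan)

lemma word_prob_Nil [simp]: "word_prob p [] = 1"
  by (simp add: word_prob_def)

lemma word_prob_append: "word_prob p (v @ w) = word_prob p v * word_prob p w"
  by (simp add: word_prob_eq_prod_list)

lemma word_prob_nonneg: "0 \<le> word_prob p w"
  by (simp add: word_prob_def prod_nonneg)

lemma word_prob_pos:
  assumes "set w \<subseteq> set_pmf p"
  shows "0 < word_prob p w"
  unfolding word_prob_def using assms nth_mem
  by (intro prod_pos) (auto intro!: pmf_positive)

text \<open>The last letter is split off, not the first, because the later arguments extend a word
  to the right, one letter per unit of time.\<close>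

lemma sum_words_Suc:
  "(\<Sum>v\<in>words r (Suc m). g v) = (\<Sum>v\<in>words r m. \<Sum>x<r. g (v @ [x]))"
proof -
  have "words r (Suc m) = (\<lambda>(v, x). v @ [x]) ` (words r m \<times> {..<r})"
  proof (intro equalityI subsetI)
    fix v assume "v \<in> words r (Suc m)"
    then show "v \<in> (\<lambda>(v, x). v @ [x]) ` (words r m \<times> {..<r})"
      by (cases v rule: rev_cases) (auto simp: words_def)
  qed (auto simp: words_def)
  then have "(\<Sum>v\<in>words r (Suc m). g v) = (\<Sum>(v, x)\<in>words r m \<times> {..<r}. g (v @ [x]))"
    by (simp add: sum.reindex inj_on_def case_prod_unfold)
  then show ?thesis
    by (simp add: sum.cartesian_product)
qed

lemma sum_word_prob_words:
  assumes "set_pmf p = {..<r}"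
  shows "(\<Sum>v\<in>words r m. word_prob p v) = 1"
proof (induction m)
  case 0
  then show ?case by (simp add: words_0)
next
  case (Suc m)
  have "(\<Sum>x<r. pmf p x) = 1"
    by (rule sum_pmf_eq_1) (use assms in auto)
  then have "(\<Sum>x<r. word_prob p [x]) = 1"
    by (simp add: word_prob_eq_prod_list)
  then show ?case
    using Suc by (simp add: sum_words_Suc word_prob_append flip: sum_distrib_left)
qed

lemma sum_of_bool_mult_filter:
  fixes g :: "'a \<Rightarrow> 'b::semiring_1"
  assumes "finite A"
  shows "(\<Sum>x\<in>A. of_bool (P x) * g x) = (\<Sum>x\<in>{x\<in>A. P x}. g x)"
  using assms by (simp add: Int_def)

section \<open>Avoidance and first-hit probabilities as finite sums\<close>

text \<open>This is \<open>P(T > m)\<close>, written as a finite sum so that the combinatorics stays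
  free of measure theory; \<open>less_first_occ_event\<close> makes the link.\<close>

definition avoid_prob :: "nat \<Rightarrow> nat pmf \<Rightarrow> nat list \<Rightarrow> nat \<Rightarrow> real" where
  "avoid_prob r p w m = (\<Sum>v\<in>words r m. of_bool (\<not> sublist w v) * word_prob p v)"

text \<open>For nonempty \<open>v\<close> this says that the first occurrence of \<open>w\<close> in
  \<open>v\<close> ends at the last letter. It is always false for \<open>v = []\<close>, since
  \<open>butlast [] = []\<close>; only positive lengths matter below.\<close>

definition first_hit :: "'a list \<Rightarrow> 'a list \<Rightarrow> bool" where
  "first_hit w v \<longleftrightarrow> suffix w v \<and> \<not> sublist w (butlast v)"

definition hit_prob :: "nat \<Rightarrow> nat pmf \<Rightarrow> nat list \<Rightarrow> nat \<Rightarrow> real" where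
  "hit_prob r p w m = (\<Sum>v\<in>words r m. of_bool (first_hit w v) * word_prob p v)"

text \<open>If \<open>v\<close> avoids \<open>w\<close>, then \<open>v @ [x]\<close> either is a
  first hit or still avoids \<open>w\<close>, and not both. If \<open>v\<close> contains
  \<open>w\<close>, it is neither.\<close>

lemma hit_prob_Suc:
  assumes p: "set_pmf p = {..<r}"
  shows "hit_prob r p w (Suc m) = avoid_prob r p w m - avoid_prob r p w (Suc m)"
proof -
  have one: "(\<Sum>x<r. word_prob p [x]) = 1"
    using sum_word_prob_words[OF p, of 1] by (simp add: sum_words_Suc words_0)
  have "hit_prob r p w (Suc m) + avoid_prob r p w (Suc m) =
    (\<Sum>v\<in>words r m. \<Sum>x<r. (of_bool (first_hit w (v @ [x])) + of_bool (\<not> sublist w (v @ [x])))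
       * word_prob p (v @ [x]))"
    by (simp add: hit_prob_def avoid_prob_def sum_words_Suc sum.distrib distrib_right)
  also have "\<dots> = (\<Sum>v\<in>words r m. \<Sum>x<r. of_bool (\<not> sublist w v) * word_prob p v * word_prob p [x])"
    by (intro sum.cong refl) (auto simp: first_hit_def sublist_snoc word_prob_append)
  also have "\<dots> = avoid_prob r p w m"
    by (simp add: avoid_prob_def one flip: sum_distrib_left)
  finally show ?thesis by simp
qed

lemma avoid_prob_short:
  assumes p: "set_pmf p = {..<r}" and "m < length w"
  shows "avoid_prob r p w m = 1"
proof -
  have "\<not> sublist w v" if "v \<in> words r m" for v
    using that assms(2) by (auto simp: words_def dest: sublist_length_le)
  then show ?thesis
    using sum_word_prob_words[OF p] by (simp add: avoid_prob_def)
qed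

text \<open>Append \<open>w\<close> to \<open>v\<close> letter by letter. Containing
  \<open>w\<close> is a monotone property that fails at the start and holds at the end, so it
  switches on exactly once, and that switch is the first hit.\<close>

lemma ex1_first_hit:
  assumes "\<not> sublist w v"
  shows "\<exists>!k. k \<in> {1..length w} \<and> first_hit w (v @ take k w)"
proof -
  define P where "P k \<longleftrightarrow> sublist w (v @ take k w)" for k
  have mono: "P j" if "P i" "i \<le> j" for i j
  proof -
    have "take j w = take i w @ take (j - i) (drop i w)"
      using that(2) by (metis le_add_diff_inverse take_add)
    then have "sublist (v @ take i w) (v @ take j w)"
      by (simp flip: append_assoc)
    then show ?thesis
      using that(1) unfolding P_def by (rule sublist_order.order_trans[rotated])
  qed
  have P0: "\<not> P 0" and Pn: "P (length w)"
    using assms by (auto simp: P_def)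
  have hit: "first_hit w (v @ take (Suc k) w) \<longleftrightarrow> P (Suc k) \<and> \<not> P k" if "Suc k \<le> length w" for k
    using that by (auto simp: first_hit_def P_def take_Suc_conv_app_nth sublist_snoc
        simp flip: append_assoc)
  define k where "k = (LEAST k. P k)"
  have "P k" "k \<le> length w" unfolding k_def by (rule LeastI[of P, OF Pn], rule Least_le[of P, OF Pn])
  with P0 obtain l where l: "k = Suc l" by (cases k) auto
  have nl: "\<not> P l" using not_less_Least[of l P] l k_def by simp
  show ?thesis
  proof (rule ex1I[of _ k])
    show "k \<in> {1..length w} \<and> first_hit w (v @ take k w)"
      using l hit \<open>P k\<close> nl \<open>k \<le> length w\<close> by auto
    fix j assume j: "j \<in> {1..length w} \<and> first_hit w (v @ take j w)"
    then obtain i where i: "j = Suc i" by (cases j) auto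
    have "P j" "\<not> P i" using j i hit by auto
    have "k \<le> j" unfolding k_def using \<open>P j\<close> by (rule Least_le)
    moreover have "\<not> k \<le> i" using mono[OF \<open>P k\<close>] \<open>\<not> P i\<close> by blast
    ultimately    show "j = k" using i by simp
  qed
qed

text \<open>Borders arise here: \<open>w\<close> and \<open>take k w\<close> are both suffixes of
  the same word, so the shorter is a suffix of the longer.\<close>

lemma suffix_take_if_suffix_append_take:
  assumes "suffix w (v @ take k w)"
  shows "suffix (take k w) w"
  by (rule suffix_length_suffix[OF _ assms]) (auto simp: suffix_def)

text \<open>Regroup \<open>v @ w\<close> as \<open>(v @ take k w) @ drop k w\<close>. If
  \<open>take k w\<close> is a border, the first factor runs through all first-hit words of length
  \<open>m + k\<close>; otherwise no summand survives.\<close>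

lemma sum_first_hit_append_take:
  assumes w: "set w \<subseteq> {..<r}" and k: "k \<in> {1..length w}"
  shows "(\<Sum>v\<in>words r m. of_bool (\<not> sublist w v \<and> first_hit w (v @ take k w)) * word_prob p (v @ w))
    = of_bool (suffix (take k w) w) * (hit_prob r p w (m + k) * word_prob p (drop k w))"
proof (cases "suffix (take k w) w")
  case True
  have sub: "sublist (take k w) w" "set (take k w) \<subseteq> {..<r}"
    using w set_take_subset[of k w] by auto
  have "(\<Sum>v\<in>words r m. of_bool (\<not> sublist w v \<and> first_hit w (v @ take k w)) * word_prob p (v @ w))
    = (\<Sum>v\<in>{v\<in>words r m. \<not> sublist w v \<and> first_hit w (v @ take k w)}.
         word_prob p (v @ take k w) * word_prob p (drop k w))"
    by (simp only: sum_of_bool_mult_filter finite_words append_assoc append_take_drop_id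
        flip: word_prob_append)
  also have "\<dots> = (\<Sum>v\<in>{v\<in>words r (m + k). first_hit w v}. word_prob p v * word_prob p (drop k w))"
  proof (rule sum.reindex_bij_witness[of _ "take m" "\<lambda>v. v @ take k w"])
    fix v assume v: "v \<in> {v\<in>words r (m + k). first_hit w v}"
    then have "suffix w v" and len: "length v = m + k" and sv: "set v \<subseteq> {..<r}"
      and nb: "\<not> sublist w (butlast v)"
      by (auto simp: words_def first_hit_def)
    \<comment> \<open>The border condition makes every first-hit word end in
      \<open>take k w\<close>, so cutting to length \<open>m\<close> inverts the appending.\<close>
    then have "suffix (take k w) v" using True suffix_order.trans by blast
    then obtain u where u: "v = u @ take k w" by (auto simp: suffix_def)
    then have lu: "length u = m" using len k by simp
    show eq: "take m v @ take k w = v" using u lu by simp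
    \<comment> \<open>As \<open>k\<close> is positive, dropping the last letter of \<open>v\<close>
      leaves \<open>u\<close> intact.\<close>
    have "butlast v = u @ butlast (take k w)"
      using u k by (auto simp: butlast_append)
    then have "sublist u (butlast v)" by simp
    then have "\<not> sublist w u" using nb sublist_order.order_trans by blast
    then show "take m v \<in> {v\<in>words r m. \<not> sublist w v \<and> first_hit w (v @ take k w)}"
      using u lu sv v by (auto simp: words_def)
  qed (use k sub in \<open>auto simp: words_def\<close>)
  finally show ?thesis
    using True by (simp only: hit_prob_def sum_distrib_right sum_of_bool_mult_filter finite_words)
      simp
next
  case False
  then have "\<not> first_hit w (v @ take k w)" for v
    using suffix_take_if_suffix_append_take unfolding first_hit_def by blast
  with False show ?thesis by simp
qed

lemma avoid_prob_mult_word_prob: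
  assumes w: "set w \<subseteq> {..<r}"
  shows "avoid_prob r p w m * word_prob p w =
    (\<Sum>k\<in>{k\<in>{1..length w}. suffix (take k w) w}. hit_prob r p w (m + k) * word_prob p (drop k w))"
proof -
  \<comment> \<open>The avoidance event is split by the unique \<open>k\<close> from
    \<open>ex1_first_hit\<close>.\<close>
  have "(of_bool (\<not> sublist w v) :: real) =
      (\<Sum>k\<in>{1..length w}. of_bool (\<not> sublist w v \<and> first_hit w (v @ take k w)))" for v
  proof (cases "sublist w v")
    case False
    from ex1_first_hit[OF this] obtain k
      where "{k\<in>{1..length w}. first_hit w (v @ take k w)} = {k}" by blast
    then have "card {k\<in>{1..length w}. first_hit w (v @ take k w)} = 1" by simp
    then show ?thesis using False by (simp add: sum_of_bool_eq Int_def)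
  qed simp
  then have "avoid_prob r p w m * word_prob p w = (\<Sum>v\<in>words r m. \<Sum>k\<in>{1..length w}.
      of_bool (\<not> sublist w v \<and> first_hit w (v @ take k w)) * word_prob p (v @ w))"
    by (simp add: avoid_prob_def sum_distrib_right word_prob_append mult.assoc)
  also have "\<dots> = (\<Sum>k\<in>{1..length w}.
      of_bool (suffix (take k w) w) * (hit_prob r p w (m + k) * word_prob p (drop k w)))"
    by (subst sum.swap) (intro sum.cong refl sum_first_hit_append_take w)
  also have "\<dots> = (\<Sum>k\<in>{k\<in>{1..length w}. suffix (take k w) w}. hit_prob r p w (m + k) * word_prob p (drop k w))"
    by (rule sum_of_bool_mult_filter) simp
  finally show ?thesis .
qed

text \<open>The sequence decreases and is bounded below, so it converges and its differences
  \<open>hit_prob\<close> tend to 0. By \<open>avoid_prob_mult_word_prob\<close>, its product with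
  the positive number \<open>word_prob p w\<close> is a finite combination of such null
  sequences.\<close>

lemma avoid_prob_tendsto_0:
  assumes p: "set_pmf p = {..<r}" and w: "set w \<subseteq> {..<r}"
  shows "avoid_prob r p w \<longlonglongrightarrow> 0"
proof -
  have nonneg: "0 \<le> avoid_prob r p w m" for m
    by (auto simp: avoid_prob_def intro!: sum_nonneg word_prob_nonneg)
  have "0 \<le> hit_prob r p w m" for m
    by (auto simp: hit_prob_def intro!: sum_nonneg word_prob_nonneg)
  then have dec: "decseq (avoid_prob r p w)"
    using hit_prob_Suc[OF p] by (intro decseq_SucI) (metis diff_ge_0_iff_ge)
  then obtain L where L: "avoid_prob r p w \<longlonglongrightarrow> L"
    using decseq_convergent[of _ 0] nonneg by blast
  have "(\<lambda>m. hit_prob r p w (Suc m)) \<longlonglongrightarrow> L - L"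
    unfolding hit_prob_Suc[OF p] by (intro tendsto_diff L LIMSEQ_Suc)
  then have hit: "(\<lambda>m. hit_prob r p w (m + k)) \<longlonglongrightarrow> 0" for k
    by (simp add: LIMSEQ_ignore_initial_segment filterlim_sequentially_Suc)
  have "(\<lambda>m. avoid_prob r p w m * word_prob p w) \<longlonglongrightarrow> 0"
    unfolding avoid_prob_mult_word_prob[OF w] by (intro tendsto_null_sum tendsto_mult_left_zero hit)
  then have "(\<lambda>m. avoid_prob r p w m * word_prob p w / word_prob p w) \<longlonglongrightarrow> 0"
    by (rule tendsto_divide_zero)
  then show ?thesis
    using word_prob_pos[of w p] p w by simp
qed

text \<open>For each border the series over \<open>m\<close> telescopes from
  \<open>avoid_prob r p w (k - 1)\<close> down to 0. The starting value is 1, because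
  \<open>k - 1 < length w\<close>.\<close>

lemma avoid_prob_sums:
  assumes p: "set_pmf p = {..<r}" and w: "set w \<subseteq> {..<r}"
  shows "(\<lambda>m. avoid_prob r p w m * word_prob p w) sums
    (\<Sum>k\<in>{k\<in>{1..length w}. suffix (take k w) w}. word_prob p (drop k w))"
  unfolding avoid_prob_mult_word_prob[OF w]
proof (rule sums_sum)
  fix k assume k: "k \<in> {k\<in>{1..length w}. suffix (take k w) w}"
  then obtain j where j: "k = Suc j" by (cases k) auto
  have "(\<lambda>m. avoid_prob r p w (m + j)) \<longlonglongrightarrow> 0"
    by (intro LIMSEQ_ignore_initial_segment avoid_prob_tendsto_0 p w)
  from telescope_sums'[OF this]
  have "(\<lambda>m. hit_prob r p w (m + k)) sums 1"
    using hit_prob_Suc[OF p] avoid_prob_short[OF p, of j w] k j by simp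
  from sums_mult2[OF this, of "word_prob p (drop k w)"]
  show "(\<lambda>m. hit_prob r p w (m + k) * word_prob p (drop k w)) sums word_prob p (drop k w)"
    by simp
qed

section \<open>From finite words to the random infinite word\<close>

text \<open>This reduces the infimum over the whole stream to its first \<open>m\<close> letters;
  the case where \<open>w\<close> never occurs is included.\<close>

lemma less_first_occ_iff: "enat m < first_occ w \<xi> \<longleftrightarrow> \<not> sublist w (stake m \<xi>)"
proof
  assume *: "enat m < first_occ w \<xi>"
  show "\<not> sublist w (stake m \<xi>)"
  proof
    assume "sublist w (stake m \<xi>)"
    then obtain a b where ab: "stake m \<xi> = a @ w @ b" by (auto simp: sublist_def)
    have "\<xi> = a @- w @- (b @- sdrop m \<xi>)"
      using stake_sdrop[of m \<xi>] ab by (simp add: shift_append)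
    then have "first_occ w \<xi> \<le> enat (length (a @ w))"
      unfolding first_occ_def by (intro Inf_lower) blast
    moreover have "length (a @ w) \<le> m" using arg_cong[OF ab, of length] by simp
    ultimately show False using * by (meson enat_ord_simps(1) leD order_trans)
  qed
next
  assume *: "\<not> sublist w (stake m \<xi>)"
  have "enat (Suc m) \<le> first_occ w \<xi>"
    unfolding first_occ_def
  proof (rule Inf_greatest, clarify)
    fix a \<xi>' assume \<xi>: "\<xi> = a @- w @- \<xi>'"
    show "enat (Suc m) \<le> enat (length (a @ w))"
    proof (rule ccontr)
      assume "\<not> ?thesis"
      then have "length (a @ w) \<le> m" by simp
      then have "stake m \<xi> = a @ w @ stake (m - length (a @ w)) \<xi>'"
        unfolding \<xi> by (simp add: stake_shift take_all)
      with * show False by (auto simp: sublist_def)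
    qed
  qed
  then show "enat m < first_occ w \<xi>"
    by (meson enat_ord_simps(2) lessI less_le_trans)
qed

text \<open>Finite thresholds suffice even for infinite values: the smaller of two distinct values
  is finite and can itself serve as \<open>m\<close>.\<close>

lemma enat_eq_if_less_iff:
  fixes s t :: enat
  assumes "\<And>m. enat m < s \<longleftrightarrow> enat m < t"
  shows "s = t"
proof (rule antisym; rule ccontr)
  assume "\<not> s \<le> t"
  then show False using assms by (cases t) force+
next
  assume "\<not> t \<le> s"
  then show False using assms by (cases s) force+
qed

context prob_space
begin

context
  fixes r :: nat and p :: "nat pmf" and X :: "nat \<Rightarrow> 'a \<Rightarrow> nat"
  assumes indep: "indep_vars (\<lambda>_. count_space {..<r}) X UNIV"
    and distr: "\<And>i x. x < r \<Longrightarrow> prob {\<omega> \<in> space M. X i \<omega> = x} = pmf p x"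
begin

lemma X_measurable: "X i \<in> measurable M (count_space {..<r})"
  using indep by (auto simp: indep_vars_def)

lemma X_less: "\<omega> \<in> space M \<Longrightarrow> X i \<omega> < r"
  using measurable_space[OF X_measurable] by simp

lemma prefix_event:
  assumes "v \<in> words r m"
  shows "{\<omega> \<in> space M. map (\<lambda>i. X i \<omega>) [0..<m] = v} \<in> events"
    and "prob {\<omega> \<in> space M. map (\<lambda>i. X i \<omega>) [0..<m] = v} = word_prob p v"
proof -
  have v: "length v = m" "\<And>i. i < m \<Longrightarrow> v ! i < r"
    using assms nth_mem by (fastforce simp: words_def)+
  have eq: "{\<omega> \<in> space M. map (\<lambda>i. X i \<omega>) [0..<m] = v} =
      {\<omega> \<in> space M. \<forall>i<m. X i \<omega> = v ! i}"
    using v by (auto simp: list_eq_iff_nth_eq)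
  have meas: "X i -` {v ! i} \<inter> space M \<in> events" if "i < m" for i
    by (rule measurable_sets[OF X_measurable]) (use v that in auto)
  \<comment> \<open>For \<open>m = 0\<close> the intersection would be \<open>UNIV\<close> instead
    of \<open>space M\<close>, so that case is treated apart.\<close>
  have eq': "{\<omega> \<in> space M. \<forall>i<m. X i \<omega> = v ! i} = (\<Inter>i\<in>{..<m}. X i -` {v ! i} \<inter> space M)"
    if "m \<noteq> 0" using that by auto
  show "{\<omega> \<in> space M. map (\<lambda>i. X i \<omega>) [0..<m] = v} \<in> events"
    unfolding eq
  proof (cases "m = 0")
    case False
    show "{\<omega> \<in> space M. \<forall>i<m. X i \<omega> = v ! i} \<in> events"
      unfolding eq'[OF False] using False meas by (intro sets.finite_INT) auto
  qed simp
  show "prob {\<omega> \<in> space M. map (\<lambda>i. X i \<omega>) [0..<m] = v} = word_prob p v"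
  proof (cases "m = 0")
    case False
    have "prob (\<Inter>i\<in>{..<m}. X i -` {v ! i} \<inter> space M) =
        (\<Prod>i<m. prob (X i -` {v ! i} \<inter> space M))"
      using False v by (intro indep_varsD[OF indep]) auto
    also have "\<dots> = (\<Prod>i<m. pmf p (v ! i))"
      using v distr by (intro prod.cong refl) (simp add: vimage_def Int_def conj_commute)
    finally show ?thesis
      unfolding eq eq'[OF False] by (simp add: word_prob_def v)
  qed (use v in \<open>simp add: prob_space\<close>)
qed

lemma less_first_occ_event:
  shows "{\<omega> \<in> space M. enat m < first_occ w (to_stream (\<lambda>i. X i \<omega>))} \<in> events" (is "?S \<in> _")
    and "prob {\<omega> \<in> space M. enat m < first_occ w (to_stream (\<lambda>i. X i \<omega>))} = avoid_prob r p w m"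
proof -
  let ?V = "{v\<in>words r m. \<not> sublist w v}"
  let ?C = "\<lambda>v. {\<omega> \<in> space M. map (\<lambda>i. X i \<omega>) [0..<m] = v}"
  have stake: "stake m (to_stream Y) = map Y [0..<m]" for Y :: "nat \<Rightarrow> nat"
    by (simp add: list_eq_iff_nth_eq to_stream_def)
  have eq: "?S = (\<Union>v\<in>?V. ?C v)"
    using X_less by (auto simp: less_first_occ_iff stake words_def)
  show "?S \<in> events"
    unfolding eq by (intro sets.finite_UN prefix_event) auto
  have "prob ?S = (\<Sum>v\<in>?V. prob (?C v))"
    unfolding eq by (intro finite_measure_finite_Union)
      (auto simp: disjoint_family_on_def intro: prefix_event)
  also have "\<dots> = (\<Sum>v\<in>?V. word_prob p v)"
    by (intro sum.cong refl prefix_event) simp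
  also have "\<dots> = avoid_prob r p w m"
    unfolding avoid_prob_def by (rule sum_of_bool_mult_filter[symmetric]) simp
  finally show "prob ?S = avoid_prob r p w m" .
qed

text \<open>The type \<open>enat\<close> is countable, so the level sets of \<open>T\<close>
  suffice, and each is cut out by countably many conditions on the events
  \<open>T > m\<close>.\<close>

lemma first_occ_measurable:
  "(\<lambda>\<omega>. first_occ w (to_stream (\<lambda>i. X i \<omega>))) \<in> measurable M (count_space UNIV)"
proof -
  let ?T = "\<lambda>\<omega>. first_occ w (to_stream (\<lambda>i. X i \<omega>))"
  have [measurable]: "Measurable.pred M (\<lambda>\<omega>. enat m < ?T \<omega>)" for m
    using less_first_occ_event(1) by (simp add: pred_def)
  have eq: "?T \<omega> = t \<longleftrightarrow> (\<forall>m. enat m < ?T \<omega> \<longleftrightarrow> enat m < t)" for \<omega> t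
    using enat_eq_if_less_iff[of "?T \<omega>" t] by auto
  have "Measurable.pred M (\<lambda>\<omega>. ?T \<omega> = t)" for t
    unfolding eq by measurable
  then show ?thesis
    by (subst measurable_count_space_eq_countable) (auto simp: pred_def vimage_def Int_def conj_commute)
qed

lemma word_prob_mult_expected_first_occ:
  assumes p: "set_pmf p = {..<r}" and w: "set w \<subseteq> {..<r}"
  shows "ennreal (word_prob p w) * expected_first_occ M X w =
    ennreal (\<Sum>k\<in>{k\<in>{1..length w}. suffix (take k w) w}. word_prob p (drop k w))"
proof -
  have nonneg: "0 \<le> avoid_prob r p w m" for m
    by (auto simp: avoid_prob_def intro!: sum_nonneg word_prob_nonneg)
  have "expected_first_occ M X w = (\<Sum>m. ennreal (avoid_prob r p w m))"
    unfolding expected_first_occ_def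
    \<comment> \<open>The tail-sum formula \<open>E(T) = (\<Sum>m. P(T > m))\<close> holds in
      \<open>[0,\<infinity>]\<close>, so finiteness of the expectation comes out as a
      result.\<close>
    by (subst nn_integral_enat_function[OF first_occ_measurable])
      (simp add: emeasure_eq_measure less_first_occ_event(2))
  then have "ennreal (word_prob p w) * expected_first_occ M X w =
      (\<Sum>m. ennreal (avoid_prob r p w m * word_prob p w))"
    by (simp add: ennreal_suminf_cmult ennreal_mult' word_prob_nonneg nonneg mult.commute
        flip: ennreal_suminf_cmult)
  also have "\<dots> = ennreal (\<Sum>k\<in>{k\<in>{1..length w}. suffix (take k w) w}. word_prob p (drop k w))"
    by (intro suminf_ennreal_eq avoid_prob_sums p w mult_nonneg_nonneg nonneg word_prob_nonneg)
  finally show ?thesis .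
qed

end

end

section \<open>Borders and periods, and the sum over all words\<close>

text \<open>A border of length \<open>k\<close> amounts to a period \<open>n - k\<close>.\<close>

lemma bij_betw_drop_bordered:
  assumes "k < n"
  shows "bij_betw (drop k) {w\<in>words r n. suffix (take k w) w} (words r (n - k))"
proof -
  define d where "d = n - k"
  then have d: "d > 0" "n = k + d" using assms by auto
  have border: "suffix (take k w) w \<longleftrightarrow> (\<forall>i<k. w ! (i + d) = w ! i)" if "length w = n" for w :: "nat list"
  proof -
    have "suffix (take k w) w \<longleftrightarrow> take k w = drop d w"
    proof
      assume "suffix (take k w) w"
      then obtain u where u: "w = u @ take k w" by (auto simp: suffix_def)
      then have "length w = length u + length (take k w)" by (metis length_append)
      then have "length u = d" using that d by simp
      then show "take k w = drop d w" using u by (metis append_eq_conv_conj)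
    qed (metis suffix_drop)
    also have "\<dots> \<longleftrightarrow> (\<forall>i<k. w ! (i + d) = w ! i)"
      using that d by (auto simp: list_eq_iff_nth_eq add.commute)
    finally show ?thesis .
  qed
  show ?thesis
  proof (rule bij_betw_imageI)
    show "inj_on (drop k) {w\<in>words r n. suffix (take k w) w}"
    proof (rule inj_onI)
      fix v w assume "v \<in> {w\<in>words r n. suffix (take k w) w}" "w \<in> {w\<in>words r n. suffix (take k w) w}"
        and eq: "drop k v = drop k w"
      then have len: "length v = n" "length w = n"
        and per: "\<And>i. i < k \<Longrightarrow> v ! (i + d) = v ! i" "\<And>i. i < k \<Longrightarrow> w ! (i + d) = w ! i"
        using border by (auto simp: words_def)
      have "v ! i = w ! i" if "i < n" for i
        using that
      \<comment> \<open>The induction runs from right to left: positions from \<open>k\<close> on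
        agree by \<open>eq\<close>, and an earlier letter equals the one \<open>d\<close> places to
        its right.\<close>
      proof (induction "n - i" arbitrary: i rule: less_induct)
        case less
        show ?case
        proof (cases "i < k")
          case True
          then have "v ! (i + d) = w ! (i + d)"
            using less d by (intro less.hyps) auto
          then show ?thesis using per True by simp
        next
          case False
          then have "v ! i = drop k v ! (i - k)" "w ! i = drop k w ! (i - k)"
            using len less.prems by auto
          then show ?thesis using eq by simp
        qed
      qed
      then show "v = w" using len by (simp add: list_eq_iff_nth_eq)
    qed
    show "drop k ` {w\<in>words r n. suffix (take k w) w} = words r (n - k)"
    proof (intro equalityI subsetI)
      fix s assume s: "s \<in> words r (n - k)"
      then have len: "length s = d" by (simp add: words_def d_def)
      \<comment> \<open>The index is \<open>(i - k) mod d\<close>, written without subtraction of \<open>k\<close>.\<close>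
      define w where "w = map (\<lambda>i. s ! ((i + (d - 1) * k) mod d)) [0..<n]"
      have "set w \<subseteq> set s" using len d by (auto simp: w_def)
      then have "w \<in> words r n" using s by (auto simp: words_def w_def)
      moreover have "suffix (take k w) w"
        by (subst border) (use d in \<open>auto simp: w_def add.assoc add.left_commute[of _ d]\<close>)
      moreover have "drop k w = s"
      proof (rule nth_equalityI)
        fix i assume "i < length (drop k w)"
        then have i: "i < d" using d by (simp add: w_def)
        have "k + i + (d - 1) * k = i + d * k"
          using d by (cases d) auto
        then have "(k + i + (d - 1) * k) mod d = i"
          using i by (simp only: mod_mult_self2 mod_less)
        then show "drop k w ! i = s ! i"
          using i d by (simp add: w_def)
      qed (use d len in \<open>simp add: w_def\<close>)
      ultimately show "s \<in> drop k ` {w\<in>words r n. suffix (take k w) w}" by blast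
    qed (auto simp: words_def dest: in_set_dropD)
  qed
qed

lemma sum_border_word_prob:
  assumes p: "set_pmf p = {..<r}" and "n > 0"
  shows "(\<Sum>w\<in>words r n. \<Sum>k\<in>{k\<in>{1..length w}. suffix (take k w) w}. word_prob p (drop k w))
    = real r ^ n + real n - 1"
proof -
  let ?B = "\<lambda>k. {w\<in>words r n. suffix (take k w) w}"
  have "(\<Sum>w\<in>words r n. \<Sum>k\<in>{k\<in>{1..length w}. suffix (take k w) w}. word_prob p (drop k w))
    = (\<Sum>w\<in>words r n. \<Sum>k\<in>{k\<in>{1..n}. suffix (take k w) w}. word_prob p (drop k w))"
    by (intro sum.cong refl) (simp add: words_def)
  also have "\<dots> = (\<Sum>k\<in>{1..n}. \<Sum>w\<in>?B k. word_prob p (drop k w))"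
    by (rule sum.swap_restrict) auto
  \<comment> \<open>The trivial border \<open>k = n\<close> is separated: every word has it, and
    \<open>drop n w\<close> is empty with probability 1.\<close>
  also have "{1..n} = insert n {1..<n}" using \<open>n > 0\<close> by auto
  also have "(\<Sum>k\<in>insert n {1..<n}. \<Sum>w\<in>?B k. word_prob p (drop k w))
    = (\<Sum>w\<in>?B n. word_prob p (drop n w)) + (\<Sum>k\<in>{1..<n}. \<Sum>w\<in>?B k. word_prob p (drop k w))"
    by simp
  also have "?B n = words r n" by (auto simp: words_def)
  also have "(\<Sum>w\<in>words r n. word_prob p (drop n w)) = (\<Sum>w\<in>words r n. 1)"
    by (intro sum.cong refl) (simp add: words_def)
  also have "\<dots> = real r ^ n" by (simp add: card_words)
  \<comment> \<open>By the bijection each inner sum is the total mass of the words of length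
    \<open>n - k\<close>.\<close>
  also have "(\<Sum>k\<in>{1..<n}. \<Sum>w\<in>?B k. word_prob p (drop k w)) = (\<Sum>k\<in>{1..<n}. 1)"
    using sum.reindex_bij_betw[OF bij_betw_drop_bordered, of _ n "word_prob p" r]
    by (intro sum.cong refl) (simp add: sum_word_prob_words[OF p])
  finally show ?thesis using \<open>n > 0\<close> by simp
qed

theorem mainTheorem2:
  fixes r n :: nat and p :: "nat pmf" and M :: "'s measure" and X :: "nat \<Rightarrow> 's \<Rightarrow> nat"
  assumes "r \<ge> 2"
    and "set_pmf p = {..<r}"
    and "prob_space M"
    and "prob_space.indep_vars M (\<lambda>_. count_space {..<r}) X UNIV"
    and "\<And>i x. x < r \<Longrightarrow> measure M {\<omega> \<in> space M. X i \<omega> = x} = pmf p x"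
  shows "(\<Sum>w\<in>words r n. ennreal (word_prob p w) * expected_first_occ M X w)
           = ennreal (real r ^ n + real n - 1)"
proof -
  have "(\<Sum>w\<in>words r n. ennreal (word_prob p w) * expected_first_occ M X w) =
    (\<Sum>w\<in>words r n. ennreal (\<Sum>k\<in>{k\<in>{1..length w}. suffix (take k w) w}. word_prob p (drop k w)))"
    by (intro sum.cong refl prob_space.word_prob_mult_expected_first_occ[OF assms(3,4,5,2)])
      (auto simp: words_def)
  also have "\<dots> = ennreal (\<Sum>w\<in>words r n. \<Sum>k\<in>{k\<in>{1..length w}. suffix (take k w) w}. word_prob p (drop k w))"
    by (intro sum_ennreal sum_nonneg word_prob_nonneg)
  also have "(\<Sum>w\<in>words r n. \<Sum>k\<in>{k\<in>{1..length w}. suffix (take k w) w}. word_prob p (drop k w))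
    = real r ^ n + real n - 1"
    \<comment> \<open>For \<open>n = 0\<close> the empty word leaves no \<open>k\<close> to sum
      over, and the right-hand side is \<open>1 + 0 - 1 = 0\<close>.\<close>
    using sum_border_word_prob[OF assms(2)] by (cases "n = 0") (auto simp: words_0)
  finally show ?thesis .
qed

end
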